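(* Let the system, constraints and notation be as in the context (in particular, the standing assumptions listed there hold), and assume $\mathbf{E}[\boldsymbol\varphi(\mathbf{G}\mathbf{w})]=0$. For each $x\in\mathbb{R}^{n_x}$ let $(\mathbf{M}^{s\star}(x),\mathbf{v}^{s\star}(x))$ be the $(\mathbf{M},\mathbf{v})$-part of an optimizer of the program $\mathbb{P}^s_N(x)$ of the context, and let $\kappa_N^s(x)=v_0^{s\star}(x)\in\mathbb{R}^{n_u}$ be the first block of $\mathbf{v}^{s\star}(x)$, the map $\kappa_N^s$ being Borel measurable. Then the closed-loop system $$x_{t+1}=Ax_t+B\kappa_N^s(x_t)+Gw_t,\qquad t\in\mathbb{N}_0,$$ is stochastically stable; more precisely, $\sup_{t\in\mathbb{N}_0}\mathbf{E}_{x_0}[\|x_t\|^2]<\infty$ for all $x_0\in\mathbb{R}^{n_x}$.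
   Context: Notation: $\|\cdot\|$ is the Euclidean norm; $\|y\|_A^2:=y^\top Ay$; $\mathbf{E}_{x_0}$ is the conditional expectation given the initial state $x_0$; $\mathbb{N}_0=\{0,1,2,\dots\}$; $\mathbb{R}_+$ is the set of nonnegative reals; $\mathrm{vec}$ is column-stacking vectorization; $\otimes$ is the Kronecker product; $\mathbf{1}$ is the all-ones vector; $\mathbb{S}^n_{+}$, $\mathbb{S}^n_{++}$ are the symmetric positive semidefinite / positive definite $n\times n$ matrices. System: $x^+=Ax+Bu+Gw$ with $x\in\mathbb{R}^{n_x}$, $u\in\mathbb{R}^{n_u}$, $w\in\mathbb{R}^{n_w}$. Standing assumptions: (i) $A$ is Schur stable (all eigenvalues strictly inside the unit circle); (ii) states are observed exactly; (iii) the disturbances $w_t$ are i.i.d., zero mean, with covariance $\Sigma_w\in\mathbb{S}^{n_w}_{++}$ and known density $p_w$ with possibly unbounded support $\Delta_w\subseteq\mathbb{R}^{n_w}$; (iv) hard input constraints $u\in\mathbb{U}=\{u\in\mathbb{R}^{n_u}: H_uu\le k_u\}$, $H_u\in\mathbb{R}^{s\times n_u}$, with $\mathbb{U}$ compact and containing the origin in its interior; (v) joint state chance constraint $\mathbf{Pr}[x\in\mathbb{X}]\ge1-\beta$, $\beta\in[0,1)$, $\mathbb{X}=\{x: H_xx\le k_x\}$, $H_x\in\mathbb{R}^{r\times n_x}$. Stacked notation over a horizon $N\in\mathbb{N}$: $\mathbf{w}=[w_0^\top,\dots,w_{N-1}^\top]^\top$ with i.i.d. $w_i$ of density $p_w$,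 $\Sigma_{\mathbf{w}}=I_N\otimes\Sigma_w$; $\mathbf{A}=[I,A^\top,\dots,(A^N)^\top]^\top$; $\mathbf{D}\in\mathbb{R}^{n_x(N+1)\times n_xN}$ has, for $p\in\{0,\dots,N\}$, $q\in\{0,\dots,N-1\}$, $(p,q)$ block equal to $A^{p-1-q}$ if $q\le p-1$ and $0$ otherwise; $\mathbf{B}=\mathbf{D}(I_N\otimes B)$; $\mathbf{G}=I_N\otimes G$. Weights $Q\in\mathbb{S}^{n_x}_+$, $R\in\mathbb{S}^{n_u}_+$; $\mathbf{Q}=I_{N+1}\otimes Q$, $\mathbf{R}=I_N\otimes R$. $\mathbf{H}_u=I_N\otimes H_u$, $\mathbf{k}_u=[k_u^\top,\dots,k_u^\top]^\top$. $\mathbf{H}_x^{[i]}=e_{i+1}^\top\otimes H_x$ with $e_{i+1}$ the $(i+1)$th standard basis vector of $\mathbb{R}^{N+1}$, and $\mathbf{H}^{[i]}_{x,j}$ its $j$th row. Saturation: $\boldsymbol\varphi(\mathbf{G}\mathbf{w})$ applies scalar (measurable) functions $\varphi_i^l:\mathbb{R}\to\mathbb{R}$ componentwise to the entries of $Gw_i$, $i=0,\dots,N-1$, $l=1,\dots,n_x$, with $\sup_a|\varphi_i^l(a)|\le\varphi_{\max}$. $\mathcal{W}=\{\omega\in\mathbb{R}^{n_xN}:\mathbf{H}_w\omega\le\mathbf{k}_w\}$ is a polytope (bounded polyhedron), $\mathbf{H}_w\in\mathbb{R}^{a\times n_xN}$, $\mathbf{k}_w\in\mathbb{R}^a$, with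 $\boldsymbol\varphi(\mathbf{G}\mathbf{w})\in\mathcal{W}$ for all $\mathbf{w}\in\Delta_w^N$. Program $\mathbb{P}^s_N(x)$, for fixed $\rho\in\mathbb{R}_+$, $\delta_j\in\mathbb{R}_+$, $\alpha_j\in[0,1)$ ($j=1,\dots,r$) with $\sum_j\alpha_j=\beta$: minimize over $\mathbf{M}\in\mathbb{R}^{n_uN\times n_xN}$, $\mathbf{v}\in\mathbb{R}^{n_uN}$, $\mathbf{Z}\in\mathbb{R}^{a\times sN}$, $\boldsymbol\epsilon=(\epsilon^m_{i,j},\epsilon^v_{i,j})\in\mathbb{R}^{2rN}$ the objective $$\mathbf{b}^\top\mathbf{v}+\|\mathbf{v}\|^2_{\mathbf{S}_1}+\nu^\top\mathbf{m}+\|\mathbf{m}\|^2_{\Lambda}+\rho\,\mathbf{1}^\top\boldsymbol\epsilon,\qquad \mathbf{m}=\mathrm{vec}(\mathbf{M}),$$ subject to: $\mathbf{M}$ strictly block lower triangular (in its $N\times N$ array of $n_u\times n_x$ blocks); $\mathbf{H}_u\mathbf{v}+\mathbf{Z}^\top\mathbf{k}_w\le\mathbf{k}_u$; $\mathbf{Z}^\top\mathbf{H}_w=\mathbf{H}_u\mathbf{M}$; $\mathbf{Z}\ge0$ element-wise; and for all $i\in\{1,\dots,N\}$, $j\in\{1,\dots,r\}$: $\mathbf{H}^{[i]}_{x,j}\mathbf{A}x+\mathbf{H}^{[i]}_{x,j}\mathbf{B}\mathbf{v}\le k_{x,j}-\delta_j+\epsilon^m_{i,j}$, $\|\mathbf{y}_{i,j}\|^2_{\Omega_1}+\mathbf{q}_{i,j}^\top\mathbf{y}_{i,j}+c_{i,j}\le\epsilon^v_{i,j}$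 with $\mathbf{y}_{i,j}^\top=\mathbf{H}^{[i]}_{x,j}\mathbf{B}\mathbf{M}$, $\epsilon^m_{i,j}\ge0$, $\epsilon^v_{i,j}\ge0$. Here $\mathbf{b}^\top=2x^\top\mathbf{A}^\top\mathbf{Q}\mathbf{B}$, $\mathbf{S}_1=\mathbf{B}^\top\mathbf{Q}\mathbf{B}+\mathbf{R}$, $\mathbf{S}_2=2\mathbf{G}^\top\mathbf{D}^\top\mathbf{Q}\mathbf{B}$, $\Omega_1=\mathbf{E}[\boldsymbol\varphi(\mathbf{G}\mathbf{w})\boldsymbol\varphi(\mathbf{G}\mathbf{w})^\top]$, $\Omega_2=\mathbf{E}[\boldsymbol\varphi(\mathbf{G}\mathbf{w})\mathbf{w}^\top]$, $\Lambda=\Omega_1\otimes\mathbf{S}_1^\top$, $\nu=\mathrm{vec}(\mathbf{S}_2^\top\Omega_2^\top)$, $\mathbf{q}_{i,j}^\top=2\mathbf{H}^{[i]}_{x,j}\mathbf{D}\mathbf{G}\Omega_2^\top$, $c_{i,j}=\mathbf{H}^{[i]}_{x,j}\mathbf{D}\mathbf{G}\Sigma_{\mathbf{w}}\mathbf{G}^\top\mathbf{D}^\top\mathbf{H}^{[i]\top}_{x,j}-\alpha_j\delta_j^2(1-\alpha_j)^{-1}$. *)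

theory Defs
  imports "HOL-Probability.Probability"
begin

section \<open>Matrix notions\<close>

text \<open>The instance of \<open>^\<close> on square matrices of type \<open>vec\<close> is the entrywise power, so the
  power with respect to \<open>**\<close> is introduced here.\<close>

primrec matpow :: "real^'n^'n \<Rightarrow> nat \<Rightarrow> real^'n^'n" where
  "matpow A 0 = mat 1"
| "matpow A (Suc k) = A ** matpow A k"

definition schur_stable :: "real^'n^'n \<Rightarrow> bool" where
  "schur_stable A \<longleftrightarrow>
     (\<forall>(l::complex) (z::complex^'n).
        z \<noteq> 0 \<and> map_matrix complex_of_real A *v z = l *s z \<longrightarrow> cmod l < 1)"

definition wnormsq :: "real^'n^'n \<Rightarrow> real^'n \<Rightarrow> real" where
  "wnormsq A y = y \<bullet> (A *v y)"

definition sym_psd :: "real^'n^'n \<Rightarrow> bool" where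
  "sym_psd A \<longleftrightarrow> transpose A = A \<and> (\<forall>y. 0 \<le> wnormsq A y)"

definition sym_pd :: "real^'n^'n \<Rightarrow> bool" where
  "sym_pd A \<longleftrightarrow> transpose A = A \<and> (\<forall>y. y \<noteq> 0 \<longrightarrow> 0 < wnormsq A y)"

definition outer :: "real^'m \<Rightarrow> real^'n \<Rightarrow> real^'n^'m" where
  "outer u v = (\<chi> i j. u$i * v$j)"

text \<open>Block vectors and matrices are indexed by pairs (block index, index within the block), the
  first component being the major one. A column-stacked matrix is accordingly indexed by pairs
  (column, row).\<close>

definition kron :: "real^'n^'m \<Rightarrow> real^'q^'p \<Rightarrow> real^('n \<times> 'q)^('m \<times> 'p)" where
  "kron A B = (\<chi> i j. A $ fst i $ fst j * B $ snd i $ snd j)"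

definition block_diag :: "real^'q^'p \<Rightarrow> real^('h::finite \<times> 'q)^('h \<times> 'p)" where
  "block_diag B = kron (mat 1 :: real^'h^'h) B"

definition vec_of :: "real^'n^'m \<Rightarrow> real^('n \<times> 'm)" where
  "vec_of A = (\<chi> p. A $ snd p $ fst p)"

definition block :: "real^('h::finite \<times> 'n::finite) \<Rightarrow> 'h \<Rightarrow> real^'n" where
  "block y i = (\<chi> l. y $ (i, l))"

definition repeat_vec :: "real^'n \<Rightarrow> real^('h::finite \<times> 'n)" where
  "repeat_vec y = (\<chi> p. y $ snd p)"


section \<open>Time indices\<close>

text \<open>A horizon \<open>N \<ge> 1\<close> is represented by a finite linearly ordered type \<open>'h\<close> with
  \<open>N = CARD('h)\<close> elements. Its elements stand for the input times \<open>0, \<dots>, N-1\<close>. The state times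
  \<open>0, \<dots>, N\<close> are the elements of \<open>'h option\<close>, with \<open>None\<close> for time \<open>0\<close> and \<open>Some i\<close> for the time
  immediately after the input time \<open>i\<close>; hence \<open>Some\<close> enumerates the state times \<open>1, \<dots>, N\<close>.\<close>

definition input_time :: "'h::{finite,linorder} \<Rightarrow> nat" where
  "input_time i = card {k. k < i}"

definition state_time :: "'h::{finite,linorder} option \<Rightarrow> nat" where
  "state_time p = (case p of None \<Rightarrow> 0 | Some i \<Rightarrow> input_time i + 1)"


section \<open>Problem data\<close>

text \<open>Type parameters: state, input and disturbance dimension, horizon, number of input
  constraints, number of state constraints, number of inequalities describing the polytope that
  contains the saturated disturbances.\<close>

record ('nx::finite, 'nu::finite, 'nw::finite, 'h::"{finite,linorder}",
        's::finite, 'r::finite, 'a::finite) smpc_data =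
  A_mat :: "real^'nx^'nx"
  B_mat :: "real^'nu^'nx"
  G_mat :: "real^'nw^'nx"
  p_w :: "real^'nw \<Rightarrow> real"
  Sigma_w :: "real^'nw^'nw"
  H_u :: "real^'nu^'s"
  k_u :: "real^'s"
  H_x :: "real^'nx^'r"
  k_x :: "real^'r"
  beta :: real
  Q_wt :: "real^'nx^'nx"
  R_wt :: "real^'nu^'nu"
  phi :: "'h \<Rightarrow> 'nx \<Rightarrow> real \<Rightarrow> real"
  phi_max :: real
  H_w :: "real^('h \<times> 'nx)^'a"
  k_w :: "real^'a"
  rho :: real
  delta :: "'r \<Rightarrow> real"
  alpha :: "'r \<Rightarrow> real"

definition input_set ::
  "('nx::finite,'nu::finite,'nw::finite,'h::{finite,linorder},'s::finite,'r::finite,'a::finite) smpc_data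
    \<Rightarrow> (real^'nu) set" where
  "input_set S = {u. H_u S *v u \<le> k_u S}"

definition sat_polytope ::
  "('nx::finite,'nu::finite,'nw::finite,'h::{finite,linorder},'s::finite,'r::finite,'a::finite) smpc_data
    \<Rightarrow> (real^('h \<times> 'nx)) set" where
  "sat_polytope S = {\<omega>. H_w S *v \<omega> \<le> k_w S}"

text \<open>Distribution of one disturbance and of \<open>N\<close> stacked independent disturbances.\<close>

definition dist_law ::
  "('nx::finite,'nu::finite,'nw::finite,'h::{finite,linorder},'s::finite,'r::finite,'a::finite) smpc_data
    \<Rightarrow> (real^'nw) measure" where
  "dist_law S = density lborel (\<lambda>z. ennreal (p_w S z))"

definition stacked_law ::
  "('nx::finite,'nu::finite,'nw::finite,'h::{finite,linorder},'s::finite,'r::finite,'a::finite) smpc_data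
    \<Rightarrow> (real^('h \<times> 'nw)) measure" where
  "stacked_law S =
     distr (PiM (UNIV :: 'h set) (\<lambda>_. dist_law S)) borel (\<lambda>z. \<chi> p. z (fst p) $ snd p)"

text \<open>The support is that of the distribution, so it does not depend on the chosen version of the
  density; it is contained in the closure of \<open>{z. p_w S z \<noteq> 0}\<close>.\<close>

definition dist_support ::
  "('nx::finite,'nu::finite,'nw::finite,'h::{finite,linorder},'s::finite,'r::finite,'a::finite) smpc_data
    \<Rightarrow> (real^'nw) set" where
  "dist_support S = {z. \<forall>U. open U \<longrightarrow> z \<in> U \<longrightarrow> 0 < emeasure (dist_law S) U}"


section \<open>Stacked matrices\<close>

definition bA ::
  "('nx::finite,'nu::finite,'nw::finite,'h::{finite,linorder},'s::finite,'r::finite,'a::finite) smpc_data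
    \<Rightarrow> real^'nx^('h option \<times> 'nx)" where
  "bA S = (\<chi> p. matpow (A_mat S) (state_time (fst p)) $ snd p)"

definition bD ::
  "('nx::finite,'nu::finite,'nw::finite,'h::{finite,linorder},'s::finite,'r::finite,'a::finite) smpc_data
    \<Rightarrow> real^('h \<times> 'nx)^('h option \<times> 'nx)" where
  "bD S = (\<chi> p q.
     if input_time (fst q) < state_time (fst p)
     then matpow (A_mat S) (state_time (fst p) - 1 - input_time (fst q)) $ snd p $ snd q
     else 0)"

definition bB ::
  "('nx::finite,'nu::finite,'nw::finite,'h::{finite,linorder},'s::finite,'r::finite,'a::finite) smpc_data
    \<Rightarrow> real^('h \<times> 'nu)^('h option \<times> 'nx)" where
  "bB S = bD S ** block_diag (B_mat S)"

definition bG ::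
  "('nx::finite,'nu::finite,'nw::finite,'h::{finite,linorder},'s::finite,'r::finite,'a::finite) smpc_data
    \<Rightarrow> real^('h \<times> 'nw)^('h \<times> 'nx)" where
  "bG S = block_diag (G_mat S)"

definition bQ ::
  "('nx::finite,'nu::finite,'nw::finite,'h::{finite,linorder},'s::finite,'r::finite,'a::finite) smpc_data
    \<Rightarrow> real^('h option \<times> 'nx)^('h option \<times> 'nx)" where
  "bQ S = block_diag (Q_wt S)"

definition bR ::
  "('nx::finite,'nu::finite,'nw::finite,'h::{finite,linorder},'s::finite,'r::finite,'a::finite) smpc_data
    \<Rightarrow> real^('h \<times> 'nu)^('h \<times> 'nu)" where
  "bR S = block_diag (R_wt S)"

definition bHu ::
  "('nx::finite,'nu::finite,'nw::finite,'h::{finite,linorder},'s::finite,'r::finite,'a::finite) smpc_data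
    \<Rightarrow> real^('h \<times> 'nu)^('h \<times> 's)" where
  "bHu S = block_diag (H_u S)"

definition bku ::
  "('nx::finite,'nu::finite,'nw::finite,'h::{finite,linorder},'s::finite,'r::finite,'a::finite) smpc_data
    \<Rightarrow> real^('h \<times> 's)" where
  "bku S = repeat_vec (k_u S)"

definition bSigma ::
  "('nx::finite,'nu::finite,'nw::finite,'h::{finite,linorder},'s::finite,'r::finite,'a::finite) smpc_data
    \<Rightarrow> real^('h \<times> 'nw)^('h \<times> 'nw)" where
  "bSigma S = block_diag (Sigma_w S)"

definition bHx ::
  "('nx::finite,'nu::finite,'nw::finite,'h::{finite,linorder},'s::finite,'r::finite,'a::finite) smpc_data
    \<Rightarrow> 'h option \<Rightarrow> real^('h option \<times> 'nx)^(1 \<times> 'r)" where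
  "bHx S p = kron (rowvector (axis p 1) :: real^('h option)^1) (H_x S)"

definition bHx_row ::
  "('nx::finite,'nu::finite,'nw::finite,'h::{finite,linorder},'s::finite,'r::finite,'a::finite) smpc_data
    \<Rightarrow> 'h \<Rightarrow> 'r \<Rightarrow> real^('h option \<times> 'nx)" where
  "bHx_row S i j = bHx S (Some i) $ (1, j)"


section \<open>Saturation and its moments\<close>

definition saturate ::
  "('nx::finite,'nu::finite,'nw::finite,'h::{finite,linorder},'s::finite,'r::finite,'a::finite) smpc_data
    \<Rightarrow> real^('h \<times> 'nx) \<Rightarrow> real^('h \<times> 'nx)" where
  "saturate S y = (\<chi> p. phi S (fst p) (snd p) (y $ p))"

definition Omega1 ::
  "('nx::finite,'nu::finite,'nw::finite,'h::{finite,linorder},'s::finite,'r::finite,'a::finite) smpc_data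
    \<Rightarrow> real^('h \<times> 'nx)^('h \<times> 'nx)" where
  "Omega1 S =
     (LINT w|stacked_law S. outer (saturate S (bG S *v w)) (saturate S (bG S *v w)))"

definition Omega2 ::
  "('nx::finite,'nu::finite,'nw::finite,'h::{finite,linorder},'s::finite,'r::finite,'a::finite) smpc_data
    \<Rightarrow> real^('h \<times> 'nw)^('h \<times> 'nx)" where
  "Omega2 S = (LINT w|stacked_law S. outer (saturate S (bG S *v w)) w)"


section \<open>The optimization program\<close>

definition cost_b ::
  "('nx::finite,'nu::finite,'nw::finite,'h::{finite,linorder},'s::finite,'r::finite,'a::finite) smpc_data
    \<Rightarrow> real^'nx \<Rightarrow> real^('h \<times> 'nu)" where
  "cost_b S x = 2 *\<^sub>R (x v* (transpose (bA S) ** bQ S ** bB S))"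

definition cost_S1 ::
  "('nx::finite,'nu::finite,'nw::finite,'h::{finite,linorder},'s::finite,'r::finite,'a::finite) smpc_data
    \<Rightarrow> real^('h \<times> 'nu)^('h \<times> 'nu)" where
  "cost_S1 S = transpose (bB S) ** bQ S ** bB S + bR S"

definition cost_S2 ::
  "('nx::finite,'nu::finite,'nw::finite,'h::{finite,linorder},'s::finite,'r::finite,'a::finite) smpc_data
    \<Rightarrow> real^('h \<times> 'nu)^('h \<times> 'nw)" where
  "cost_S2 S = 2 *\<^sub>R (transpose (bG S) ** transpose (bD S) ** bQ S ** bB S)"

definition cost_Lambda ::
  "('nx::finite,'nu::finite,'nw::finite,'h::{finite,linorder},'s::finite,'r::finite,'a::finite) smpc_data
    \<Rightarrow> real^(('h \<times> 'nx) \<times> ('h \<times> 'nu))^(('h \<times> 'nx) \<times> ('h \<times> 'nu))" where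
  "cost_Lambda S = kron (Omega1 S) (transpose (cost_S1 S))"

definition cost_nu ::
  "('nx::finite,'nu::finite,'nw::finite,'h::{finite,linorder},'s::finite,'r::finite,'a::finite) smpc_data
    \<Rightarrow> real^(('h \<times> 'nx) \<times> ('h \<times> 'nu))" where
  "cost_nu S = vec_of (transpose (cost_S2 S) ** transpose (Omega2 S))"

definition con_q ::
  "('nx::finite,'nu::finite,'nw::finite,'h::{finite,linorder},'s::finite,'r::finite,'a::finite) smpc_data
    \<Rightarrow> 'h \<Rightarrow> 'r \<Rightarrow> real^('h \<times> 'nx)" where
  "con_q S i j = 2 *\<^sub>R (bHx_row S i j v* (bD S ** bG S ** transpose (Omega2 S)))"

definition con_c ::
  "('nx::finite,'nu::finite,'nw::finite,'h::{finite,linorder},'s::finite,'r::finite,'a::finite) smpc_data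
    \<Rightarrow> 'h \<Rightarrow> 'r \<Rightarrow> real" where
  "con_c S i j =
     wnormsq (bD S ** bG S ** bSigma S ** transpose (bG S) ** transpose (bD S)) (bHx_row S i j)
     - alpha S j * (delta S j)\<^sup>2 * inverse (1 - alpha S j)"

text \<open>The entry \<open>(i, j)\<close> of the slack vectors belongs to the prediction time \<open>state_time (Some i)\<close>
  and the \<open>j\<close>-th state constraint.\<close>

record ('nx::finite, 'nu::finite, 'h::finite, 's::finite, 'r::finite, 'a::finite) decision =
  dec_M :: "real^('h \<times> 'nx)^('h \<times> 'nu)"
  dec_v :: "real^('h \<times> 'nu)"
  dec_Z :: "real^('h \<times> 's)^'a"
  dec_em :: "real^('h \<times> 'r)"
  dec_ev :: "real^('h \<times> 'r)"

definition strictly_block_lower ::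
  "real^('h::{finite,linorder} \<times> 'nx::finite)^('h \<times> 'nu::finite) \<Rightarrow> bool" where
  "strictly_block_lower M \<longleftrightarrow> (\<forall>i k l m. i \<le> k \<longrightarrow> M $ (i, l) $ (k, m) = 0)"

definition objective ::
  "('nx::finite,'nu::finite,'nw::finite,'h::{finite,linorder},'s::finite,'r::finite,'a::finite) smpc_data
    \<Rightarrow> real^'nx \<Rightarrow> ('nx,'nu,'h,'s,'r,'a) decision \<Rightarrow> real" where
  "objective S x d =
     cost_b S x \<bullet> dec_v d + wnormsq (cost_S1 S) (dec_v d)
     + cost_nu S \<bullet> vec_of (dec_M d) + wnormsq (cost_Lambda S) (vec_of (dec_M d))
     + rho S * ((\<Sum>p\<in>UNIV. dec_em d $ p) + (\<Sum>p\<in>UNIV. dec_ev d $ p))"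

definition feasible ::
  "('nx::finite,'nu::finite,'nw::finite,'h::{finite,linorder},'s::finite,'r::finite,'a::finite) smpc_data
    \<Rightarrow> real^'nx \<Rightarrow> ('nx,'nu,'h,'s,'r,'a) decision \<Rightarrow> bool" where
  "feasible S x d \<longleftrightarrow>
     strictly_block_lower (dec_M d) \<and>
     bHu S *v dec_v d + transpose (dec_Z d) *v k_w S \<le> bku S \<and>
     transpose (dec_Z d) ** H_w S = bHu S ** dec_M d \<and>
     (\<forall>p q. 0 \<le> dec_Z d $ p $ q) \<and>
     (\<forall>i j.
        bHx_row S i j \<bullet> (bA S *v x) + bHx_row S i j \<bullet> (bB S *v dec_v d)
          \<le> k_x S $ j - delta S j + dec_em d $ (i, j) \<and>
        (let y = bHx_row S i j v* (bB S ** dec_M d)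
         in wnormsq (Omega1 S) y + con_q S i j \<bullet> y + con_c S i j \<le> dec_ev d $ (i, j)) \<and>
        0 \<le> dec_em d $ (i, j) \<and>
        0 \<le> dec_ev d $ (i, j))"

definition is_optimizer ::
  "('nx::finite,'nu::finite,'nw::finite,'h::{finite,linorder},'s::finite,'r::finite,'a::finite) smpc_data
    \<Rightarrow> real^'nx \<Rightarrow> ('nx,'nu,'h,'s,'r,'a) decision \<Rightarrow> bool" where
  "is_optimizer S x d \<longleftrightarrow>
     feasible S x d \<and> (\<forall>d'. feasible S x d' \<longrightarrow> objective S x d \<le> objective S x d')"

end

theory Submission
  imports Defs "HOL-Computational_Algebra.Fundamental_Theorem_Algebra"
begin

text \<open>
  The constraints of the program confine the feedback to a bounded set, and a Schur stable system
  tolerates any bounded feedback.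

  Let \<open>\<omega>\<close> be any point of the polytope \<open>\<W>\<close>. Since \<open>\<^bold>Z\<close> is nonnegative and
  \<open>\<^bold>H\<^sub>w \<omega> \<le> \<^bold>k\<^sub>w\<close>, the dual constraints give
  \<open>\<^bold>H\<^sub>u(\<^bold>v + \<^bold>M\<omega>) = \<^bold>H\<^sub>u\<^bold>v + \<^bold>Z\<^sup>T\<^bold>H\<^sub>w\<omega> \<le> \<^bold>H\<^sub>u\<^bold>v + \<^bold>Z\<^sup>T\<^bold>k\<^sub>w \<le> \<^bold>k\<^sub>u\<close>: the policy respects the hard input
  constraints for that disturbance. The first block of \<open>\<^bold>M\<omega>\<close> vanishes because \<open>\<^bold>M\<close> is strictly
  block lower triangular, so the first input itself lies in the compact set \<open>\<U>\<close>
  (\<open>feasible_first_input\<close>). The polytope has a point because the support of a probability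
  distribution is nonempty (\<open>support_nonempty\<close>). Hence the feedback is bounded, uniformly in the state.

  It remains to see that a Schur stable linear system driven by a bounded input plus noise of bounded
  second moment has bounded second moment (\<open>mean_square_bounded_of_schur_stable\<close>). Schur stability
  gives numbers \<open>a\<^sub>k\<close> with finite sum that bound the gain of \<open>A\<^sup>k\<close>
  (\<open>schur_stable_summable_gain\<close>). By the variation-of-constants formula the state is at most
  \<open>a\<^sub>t\<parallel>x\<^sub>0\<parallel>\<close> plus the convolution of \<open>a\<close> with the norms of the inputs, and Cauchy-Schwarz with the
  weights \<open>a\<^sub>k\<close> bounds the square of that convolution by \<open>\<Sum>a\<close> times the convolution of \<open>a\<close> with the
  squared norms. This bound is linear in the squared norms, so its expectation is controlled by the
  trace of the noise covariance.

  The summability of the gains is proved by an elementary substitute for the Jordan form: any vector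
  \<open>z\<close> is annihilated by some nonzero polynomial in \<open>A\<close>, and the linear factors of that polynomial are
  removed one at a time (\<open>summable_orbit_if_annihilated\<close>).
\<close>

section \<open>Powers of a Schur stable matrix\<close>

text \<open>This is \<open>p(A) z\<close>. Only the iterates of \<open>A\<close> on a vector occur, so that no ring structure on
  matrices has to be set up.\<close>

definition poly_act :: "complex poly \<Rightarrow> complex^'n^'n \<Rightarrow> complex^'n \<Rightarrow> complex^'n" where
  "poly_act p A z = (\<Sum>i\<le>degree p. coeff p i *s (((*v) A ^^ i) z))"

lemma poly_act_eq_sum:
  assumes "degree p \<le> n"
  shows "poly_act p A z = (\<Sum>i\<le>n. coeff p i *s (((*v) A ^^ i) z))"
  unfolding poly_act_def
  by (rule sum.mono_neutral_left) (use assms in \<open>auto simp: coeff_eq_0\<close>)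

lemma poly_act_0 [simp]: "poly_act 0 A z = 0"
  by (simp add: poly_act_def)

lemma poly_act_add: "poly_act (p + q) A z = poly_act p A z + poly_act q A z"
proof -
  let ?n = "max (degree p) (degree q)"
  have "degree (p + q) \<le> ?n" by (rule degree_add_le_max)
  then show ?thesis
    by (simp add: poly_act_eq_sum[of _ ?n] sum.distrib vec.scale_left_distrib)
qed

lemma poly_act_smult: "poly_act (smult c p) A z = c *s poly_act p A z"
  by (simp add: poly_act_eq_sum[of _ "degree p"] degree_smult_le vec.scale_sum_right)

lemma poly_act_pCons_0: "poly_act (pCons 0 p) A z = poly_act p A (A *v z)"
proof -
  have "poly_act (pCons 0 p) A z = (\<Sum>i\<le>Suc (degree p). coeff (pCons 0 p) i *s (((*v) A ^^ i) z))"
    by (rule poly_act_eq_sum) (rule degree_pCons_le)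
  also have "\<dots> = poly_act p A (A *v z)"
    unfolding sum.atMost_Suc_shift by (simp add: poly_act_def funpow_swap1)
  finally show ?thesis .
qed

lemma funpow_matrix_vector_linear:
  fixes A :: "'a::field^'n^'n"
  shows "((*v) A ^^ k) (c *s y + z) = c *s ((*v) A ^^ k) y + ((*v) A ^^ k) z"
  by (induction k) (simp_all add: matrix_vector_right_distrib vector_scalar_commute)

lemma poly_act_linear: "poly_act p A (c *s y + z) = c *s poly_act p A y + poly_act p A z"
  by (simp add: poly_act_def funpow_matrix_vector_linear sum.distrib vec.scale_sum_right
      vec.scale_right_distrib mult.commute)

lemma poly_act_image: "poly_act p A (A *v z) = A *v poly_act p A z"
  by (simp add: poly_act_def vec.linear_sum[OF matrix_vector_mul_linear_gen]
      vector_scalar_commute funpow_swap1)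

text \<open>The vectors \<open>z, Az, \<dots>, A\<^sup>nz\<close> are \<open>n + 1\<close> vectors in an \<open>n\<close>-dimensional space; the coefficients of a
  linear relation between them are those of \<open>p\<close>.\<close>

lemma annihilating_poly_exists:
  fixes A :: "complex^'n^'n"
  shows "\<exists>p. p \<noteq> 0 \<and> poly_act p A z = 0"
proof -
  define u where "u i = ((*v) A ^^ i) z" for i
  define n where "n = CARD('n)"
  have comb: "\<exists>p. p \<noteq> 0 \<and> poly_act p A z = 0"
    if c: "(\<Sum>i\<le>n. c i *s u i) = 0" and k: "k \<le> n" "c k \<noteq> 0" for c k
  proof (intro exI conjI)
    let ?p = "\<Sum>i\<le>n. monom (c i) i"
    have coeff: "coeff ?p j = (if j \<le> n then c j else 0)" for j
      by (simp add: coeff_sum)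
    then have "degree ?p \<le> n" by (intro degree_le) simp
    then show "poly_act ?p A z = 0"
      using c by (simp add: poly_act_eq_sum[of _ n] coeff u_def)
    show "?p \<noteq> 0" using coeff[of k] k by auto
  qed
  (* Linear dependence speaks of sets, so a repetition among the u i is a separate case. *)
  show ?thesis
  proof (cases "inj_on u {..n}")
    case True
    have "vec.dependent (u ` {..n})"
    proof (rule ccontr)
      assume "\<not> vec.dependent (u ` {..n})"
      then have "card (u ` {..n}) \<le> n"
        using vec.independent_bound_general[of "u ` {..n}"] vec.dim_subset_UNIV[of "u ` {..n}"]
        by (simp add: n_def vec.dimension_def card_cart_basis)
      then show False using card_image[OF True] by simp
    qed
    then obtain c v where c: "(\<Sum>v\<in>u ` {..n}. c v *s v) = 0" "v \<in> u ` {..n}" "c v \<noteq> 0"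
      by (auto simp: vec.dependent_finite)
    then obtain k where "k \<le> n" "v = u k" by auto
    moreover have "(\<Sum>i\<le>n. c (u i) *s u i) = 0"
      using c(1) by (simp add: sum.reindex[OF True])
    ultimately show ?thesis using comb[of "\<lambda>i. c (u i)" k] c(3) by simp
  next
    case False
    then obtain i j where ij: "i \<le> n" "j \<le> n" "i \<noteq> j" "u i = u j"
      by (auto simp: inj_on_def)
    let ?c = "\<lambda>k. if k = i then 1 else if k = j then - 1 else (0::complex)"
    have "(\<Sum>k\<le>n. ?c k *s u k) = (\<Sum>k\<in>{i, j}. ?c k *s u k)"
      by (rule sum.mono_neutral_right) (use ij in auto)
    also have "\<dots> = 0" using ij by simp
    finally show ?thesis using comb[of ?c i] ij by simp
  qed
qed

text \<open>Summing the recurrence bounds the partial sums by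
  \<open>s\<^sub>n \<le> a\<^sub>0 + \<Sum>b + c s\<^sub>n\<close>, which can be solved for \<open>s\<^sub>n\<close> as \<open>c < 1\<close>.\<close>

lemma summable_contractive_recurrence:
  fixes a b :: "nat \<Rightarrow> real"
  assumes "\<And>k. 0 \<le> a k" and b0: "\<And>k. 0 \<le> b k" and "summable b" and c: "0 \<le> c" "c < 1"
    and rec: "\<And>k. a (Suc k) \<le> c * a k + b k"
  shows "summable a"
proof (rule bounded_imp_summable)
  fix n
  let ?K = "(a 0 + suminf b) / (1 - c)"
  have "sum a {..<Suc n} \<le> a 0 + suminf b + c * sum a {..<n}"
  proof -
    have "sum a {..<Suc n} = a 0 + (\<Sum>k<n. a (Suc k))"
      by (rule sum.lessThan_Suc_shift)
    also have "\<dots> \<le> a 0 + (\<Sum>k<n. c * a k + b k)"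
      by (intro add_left_mono sum_mono rec)
    also have "\<dots> = a 0 + c * sum a {..<n} + sum b {..<n}"
      by (simp add: sum.distrib sum_distrib_left)
    also have "sum b {..<n} \<le> suminf b"
      by (rule sum_le_suminf) (use assms in auto)
    finally show ?thesis by simp
  qed
  moreover have "c * sum a {..<n} \<le> c * sum a {..n}"
    using assms by (intro mult_left_mono sum_mono2) auto
  ultimately have "(1 - c) * sum a {..n} \<le> a 0 + suminf b"
    by (simp add: lessThan_Suc_atMost algebra_simps)
  then show "sum a {..n} \<le> ?K"
    using c by (simp add: pos_le_divide_eq mult.commute)
qed (use assms in auto)

lemma norm_scalar_mult_vec: "norm (c *s z) = cmod c * norm (z :: complex^'n)"
  by (simp add: norm_vec_def norm_mult L2_set_right_distrib)

text \<open>Induction on the degree. Write \<open>p = (X - l) q\<close>. If \<open>q\<close> already annihilates \<open>z\<close>, the degree has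
  dropped. Otherwise \<open>q(A) z\<close> is an eigenvector for \<open>l\<close>, so \<open>\<bar>l\<bar> < 1\<close>; the vector \<open>y = Az - lz\<close> is
  annihilated by \<open>q\<close>, hence has a summable orbit, and \<open>A\<^sup>k\<^sup>+\<^sup>1z = l A\<^sup>kz + A\<^sup>ky\<close> is a contractive recurrence
  with a summable perturbation.\<close>

lemma summable_orbit_if_annihilated:
  fixes A :: "complex^'n^'n"
  assumes eig: "\<And>l z. z \<noteq> 0 \<Longrightarrow> A *v z = l *s z \<Longrightarrow> cmod l < 1"
    and "p \<noteq> 0" and "poly_act p A z = 0"
  shows "summable (\<lambda>k. norm (((*v) A ^^ k) z))"
  using assms(2,3)
proof (induction "degree p" arbitrary: p z)
  case 0
  then obtain c where "p = [:c:]" "c \<noteq> 0" by (metis degree_eq_zeroE pCons_0_0)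
  with 0 have "z = 0" by (simp add: poly_act_def)
  moreover have "((*v) A ^^ k) 0 = 0" for k by (induction k) auto
  ultimately show ?case by simp
next
  case (Suc m)
  obtain l where "poly p l = 0"
    using Suc fundamental_theorem_of_algebra_alt[of p]
    by (metis degree_pCons_0 nat.distinct(1))
  then obtain q where p: "p = [:- l, 1:] * q" by (auto simp: poly_eq_0_iff_dvd)
  with Suc have q: "q \<noteq> 0" by auto
  have "degree p = degree [:- l, 1:] + degree q"
    unfolding p by (rule degree_mult_eq) (use q in auto)
  then have m: "m = degree q" using Suc(2) by simp
  have p': "p = smult (- l) q + pCons 0 q" by (simp add: p)
  let ?u = "poly_act q A z"
  let ?y = "(- l) *s z + A *v z"
  have y: "poly_act q A ?y = 0"
    using Suc.prems(2) by (simp only: p' poly_act_linear poly_act_add poly_act_smult poly_act_pCons_0)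
  show ?case
  proof (cases "?u = 0")
    case True
    then show ?thesis using Suc.hyps(1)[OF m q] by simp
  next
    case False
    have "A *v ?u = l *s ?u"
      using y by (simp only: poly_act_linear poly_act_image) (simp add: add_eq_0_iff)
    with eig False have l: "cmod l < 1" by blast
    show ?thesis
    proof (rule summable_contractive_recurrence)
      show "summable (\<lambda>k. norm (((*v) A ^^ k) ?y))" by (rule Suc.hyps(1)[OF m q y])
      show "norm (((*v) A ^^ Suc k) z) \<le> cmod l * norm (((*v) A ^^ k) z) + norm (((*v) A ^^ k) ?y)" for k
      proof -
        have "((*v) A ^^ Suc k) z = l *s ((*v) A ^^ k) z + ((*v) A ^^ k) ?y"
          by (simp only: funpow_matrix_vector_linear) (simp add: funpow_swap1)
        then show ?thesis
          using norm_triangle_ineq[of "l *s ((*v) A ^^ k) z"] by (simp add: norm_scalar_mult_vec)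
      qed
    qed (use l in auto)
  qed
qed

lemma schur_stable_summable_orbit:
  fixes A :: "real^'n^'n"
  assumes "schur_stable A"
  shows "summable (\<lambda>k. norm (matpow A k *v y))"
proof -
  let ?A = "map_matrix complex_of_real A"
  let ?c = "\<lambda>y::real^'n. (\<chi> i. complex_of_real (y $ i))"
  have "?A *v ?c v = ?c (A *v v)" for v
    by (simp add: vec_eq_iff matrix_vector_mult_def map_matrix_def)
  then have "((*v) ?A ^^ k) (?c y) = ?c (matpow A k *v y)" for k
    by (induction k) (simp_all add: matrix_vector_mul_assoc)
  then have eq: "norm (((*v) ?A ^^ k) (?c y)) = norm (matpow A k *v y)" for k
    by (simp add: norm_vec_def)
  obtain p where "p \<noteq> 0" "poly_act p ?A (?c y) = 0"
    using annihilating_poly_exists by blast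
  then have "summable (\<lambda>k. norm (((*v) ?A ^^ k) (?c y)))"
    using assms by (intro summable_orbit_if_annihilated) (auto simp: schur_stable_def)
  then show ?thesis by (simp only: eq)
qed

text \<open>A matrix is determined by its action on the standard basis, so finitely many orbits control the gain
  of \<open>A\<^sup>k\<close> on all vectors.\<close>

lemma schur_stable_summable_gain:
  fixes A :: "real^'n^'n"
  assumes "schur_stable A"
  obtains a where "summable a" "\<And>k. 0 \<le> a k" "\<And>k y. norm (matpow A k *v y) \<le> a k * norm y"
proof
  let ?a = "\<lambda>k. \<Sum>i\<in>UNIV. norm (matpow A k *v axis i 1)"
  show "summable ?a" by (intro summable_sum schur_stable_summable_orbit assms)
  show "0 \<le> ?a k" for k by (simp add: sum_nonneg)
  show "norm (matpow A k *v y) \<le> ?a k * norm y" for k y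
  proof -
    have "matpow A k *v y = (\<Sum>i\<in>UNIV. y $ i *\<^sub>R (matpow A k *v axis i 1))"
      by (subst matrix_mult_sum) (simp add: matrix_vector_mult_basis scalar_mult_eq_scaleR)
    also have "norm \<dots> \<le> (\<Sum>i\<in>UNIV. norm y * norm (matpow A k *v axis i 1))"
      by (rule sum_norm_le) (simp add: mult_right_mono component_le_norm_cart)
    finally show ?thesis by (simp add: sum_distrib_left mult.commute)
  qed
qed


section \<open>Linear systems driven by additive inputs\<close>

lemma variation_of_constants:
  fixes A :: "real^'n^'n"
  assumes "\<And>t. x (Suc t) = A *v x t + y t"
  shows "x t = matpow A t *v x 0 + (\<Sum>k<t. matpow A (t - Suc k) *v y k)"
proof (induction t)
  case (Suc t)
  have "A *v (\<Sum>k<t. matpow A (t - Suc k) *v y k) = (\<Sum>k<t. matpow A (Suc t - Suc k) *v y k)"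
    unfolding vec.linear_sum[OF matrix_vector_mul_linear_gen]
    by (rule sum.cong) (auto simp: matrix_vector_mul_assoc Suc_diff_Suc simp flip: matpow.simps(2))
  then show ?case
    by (simp add: assms Suc matrix_vector_right_distrib matrix_vector_mul_assoc)
qed simp

text \<open>The Cauchy-Schwarz inequality for the vectors \<open>\<surd>a\<^sub>i\<close> and \<open>\<surd>a\<^sub>i y\<^sub>i\<close>. Splitting the weight evenly leaves
  the right-hand side linear in \<open>y\<^sub>i\<^sup>2\<close>, so that expectations can be taken term by term.\<close>

lemma weighted_sum_squared_le:
  fixes a y :: "'i \<Rightarrow> real"
  assumes "\<And>i. i \<in> I \<Longrightarrow> 0 \<le> a i"
  shows "(\<Sum>i\<in>I. a i * y i)\<^sup>2 \<le> (\<Sum>i\<in>I. a i) * (\<Sum>i\<in>I. a i * (y i)\<^sup>2)"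
proof -
  have "(\<Sum>i\<in>I. a i * y i) = (\<Sum>i\<in>I. sqrt (a i) * (sqrt (a i) * y i))"
    by (rule sum.cong) (auto simp: assms simp flip: mult.assoc)
  also have "(\<dots>)\<^sup>2 \<le> (\<Sum>i\<in>I. (sqrt (a i))\<^sup>2) * (\<Sum>i\<in>I. (sqrt (a i) * y i)\<^sup>2)"
    by (rule Cauchy_Schwarz_ineq_sum)
  also have "\<dots> = (\<Sum>i\<in>I. a i) * (\<Sum>i\<in>I. a i * (y i)\<^sup>2)"
    by (simp add: assms power_mult_distrib)
  finally show ?thesis .
qed

lemma sum_squared_le_double: "((a::real) + b)\<^sup>2 \<le> 2 * a\<^sup>2 + 2 * b\<^sup>2"
  using sum_squares_bound[of a b] by (simp add: power2_sum)

lemma state_norm_squared_le: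
  fixes A :: "real^'n^'n"
  assumes a: "summable a" "\<And>k. 0 \<le> a k" "\<And>k y. norm (matpow A k *v y) \<le> a k * norm y"
    and step: "\<And>t. x (Suc t) = A *v x t + y t"
  shows "(norm (x t))\<^sup>2 \<le> 2 * (suminf a * norm (x 0))\<^sup>2
           + 2 * suminf a * (\<Sum>k<t. a (t - Suc k) * (norm (y k))\<^sup>2)"
proof -
  have sum_a: "(\<Sum>k<t. a (t - Suc k)) \<le> suminf a"
    unfolding sum.nat_diff_reindex using a by (intro sum_le_suminf) auto
  have "a t \<le> suminf a"
    using a sum_le_suminf[of a "{t}"] by simp
  then have "norm (matpow A t *v x 0) \<le> suminf a * norm (x 0)"
    by (intro order_trans[OF a(3)] mult_right_mono) auto
  moreover have "norm (\<Sum>k<t. matpow A (t - Suc k) *v y k) \<le> (\<Sum>k<t. a (t - Suc k) * norm (y k))"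
    by (rule sum_norm_le) (rule a)
  ultimately have "norm (x t) \<le> suminf a * norm (x 0) + (\<Sum>k<t. a (t - Suc k) * norm (y k))"
    unfolding variation_of_constants[of x A y t, OF step] by (rule norm_triangle_mono)
  then have "(norm (x t))\<^sup>2 \<le> (suminf a * norm (x 0) + (\<Sum>k<t. a (t - Suc k) * norm (y k)))\<^sup>2"
    by (rule power_mono) simp
  also have "\<dots> \<le> 2 * (suminf a * norm (x 0))\<^sup>2 + 2 * (\<Sum>k<t. a (t - Suc k) * norm (y k))\<^sup>2"
    by (rule sum_squared_le_double)
  also have "(\<Sum>k<t. a (t - Suc k) * norm (y k))\<^sup>2
      \<le> (\<Sum>k<t. a (t - Suc k)) * (\<Sum>k<t. a (t - Suc k) * (norm (y k))\<^sup>2)"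
    by (rule weighted_sum_squared_le) (rule a)
  also have "\<dots> \<le> suminf a * (\<Sum>k<t. a (t - Suc k) * (norm (y k))\<^sup>2)"
    using a sum_a by (intro mult_right_mono sum_nonneg mult_nonneg_nonneg) auto
  finally show ?thesis by simp
qed

text \<open>The pathwise bound on the state is replaced by one that depends on \<open>\<omega>\<close> only through the noise. This
  majorant is integrable because the noise is square integrable, and its integral is bounded uniformly
  in \<open>t\<close> because the weights \<open>a\<^sub>k\<close> have a finite sum.\<close>

lemma mean_square_bounded_of_schur_stable:
  fixes A :: "real^'n^'n" and P :: "'o measure" and w :: "nat \<Rightarrow> 'o \<Rightarrow> real^'m"
  assumes "prob_space P" and "schur_stable A"
    and step: "\<And>t \<omega>. \<omega> \<in> space P \<Longrightarrow> x (Suc t) \<omega> = A *v x t \<omega> + y t \<omega>"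
    and init: "\<And>\<omega>. \<omega> \<in> space P \<Longrightarrow> x 0 \<omega> = x0"
    and y: "\<And>t \<omega>. \<omega> \<in> space P \<Longrightarrow> norm (y t \<omega>) \<le> c + g * norm (w t \<omega>)"
    and w: "\<And>t. integrable P (\<lambda>\<omega>. (norm (w t \<omega>))\<^sup>2)"
           "\<And>t. (LINT \<omega>|P. (norm (w t \<omega>))\<^sup>2) \<le> \<sigma>"
  shows "(SUP t. \<integral>\<^sup>+ \<omega>. ennreal ((norm (x t \<omega>))\<^sup>2) \<partial>P) < \<infinity>"
proof -
  interpret prob_space P by fact
  obtain a where a: "summable a" "\<And>k. 0 \<le> a k" "\<And>k y. norm (matpow A k *v y) \<le> a k * norm y"
    using schur_stable_summable_gain[OF \<open>schur_stable A\<close>] by blast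
  let ?s = "suminf a"
  have s: "0 \<le> ?s" using a by (simp add: suminf_nonneg)
  define m where "m = 2 * c\<^sup>2 + 2 * g\<^sup>2 * \<sigma>"
  have "0 \<le> (LINT \<omega>|P. (norm (w 0 \<omega>))\<^sup>2)" by simp
  with w(2)[of 0] have "0 \<le> \<sigma>" by linarith
  then have m: "0 \<le> m" by (simp add: m_def)
  define K where "K = 2 * (?s * norm x0)\<^sup>2 + 2 * ?s * (?s * m)"
  have "(\<integral>\<^sup>+ \<omega>. ennreal ((norm (x t \<omega>))\<^sup>2) \<partial>P) \<le> ennreal K" for t
  proof -
    let ?h = "\<lambda>\<omega>. 2 * (?s * norm x0)\<^sup>2
      + 2 * ?s * (\<Sum>k<t. a (t - Suc k) * (2 * c\<^sup>2 + 2 * g\<^sup>2 * (norm (w k \<omega>))\<^sup>2))"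
    have le: "(norm (x t \<omega>))\<^sup>2 \<le> ?h \<omega>" if \<omega>: "\<omega> \<in> space P" for \<omega>
    proof -
      have "(norm (y k \<omega>))\<^sup>2 \<le> 2 * c\<^sup>2 + 2 * g\<^sup>2 * (norm (w k \<omega>))\<^sup>2" for k
        using power_mono[OF y[OF \<omega>, of k], of 2] sum_squared_le_double[of c "g * norm (w k \<omega>)"]
        by (simp add: power_mult_distrib)
      then have "2 * ?s * (\<Sum>k<t. a (t - Suc k) * (norm (y k \<omega>))\<^sup>2)
          \<le> 2 * ?s * (\<Sum>k<t. a (t - Suc k) * (2 * c\<^sup>2 + 2 * g\<^sup>2 * (norm (w k \<omega>))\<^sup>2))"
        using a s by (intro mult_left_mono sum_mono) auto
      then show ?thesis
        using state_norm_squared_le[of a A "\<lambda>t. x t \<omega>" "\<lambda>t. y t \<omega>" t, OF a step[OF \<omega>]] init[OF \<omega>]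
        by simp
    qed
    have int: "integrable P ?h" using w by auto
    have "(\<integral>\<^sup>+ \<omega>. ennreal ((norm (x t \<omega>))\<^sup>2) \<partial>P) \<le> (\<integral>\<^sup>+ \<omega>. ennreal (?h \<omega>) \<partial>P)"
      by (rule nn_integral_mono) (simp add: le ennreal_leI)
    also have "\<dots> = ennreal (LINT \<omega>|P. ?h \<omega>)"
    proof (rule nn_integral_eq_integral[OF int])
      have "0 \<le> ?h \<omega>" for \<omega>
        using a s by (intro add_nonneg_nonneg mult_nonneg_nonneg sum_nonneg) auto
      then show "AE \<omega> in P. 0 \<le> ?h \<omega>" by simp
    qed
    also have "(LINT \<omega>|P. ?h \<omega>) \<le> K"
    proof -
      have "(LINT \<omega>|P. ?h \<omega>) = 2 * (?s * norm x0)\<^sup>2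
          + 2 * ?s * (\<Sum>k<t. a (t - Suc k) * (2 * c\<^sup>2 + 2 * g\<^sup>2 * (LINT \<omega>|P. (norm (w k \<omega>))\<^sup>2)))"
        using w by (simp add: prob_space)
      also have "\<dots> \<le> 2 * (?s * norm x0)\<^sup>2 + 2 * ?s * (\<Sum>k<t. a (t - Suc k) * m)"
        unfolding m_def
        using a s w by (intro add_left_mono mult_left_mono sum_mono) auto
      also have "(\<Sum>k<t. a (t - Suc k) * m) \<le> ?s * m"
        unfolding sum_distrib_right[symmetric] sum.nat_diff_reindex
        using a m by (intro mult_right_mono sum_le_suminf) auto
      finally show ?thesis using s by (simp add: K_def mult_left_mono)
    qed
    finally show ?thesis by (simp add: ennreal_leI)
  qed
  then have "(SUP t. \<integral>\<^sup>+ \<omega>. ennreal ((norm (x t \<omega>))\<^sup>2) \<partial>P) \<le> ennreal K"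
    by (rule SUP_least)
  then show ?thesis by (rule order_le_less_trans) simp
qed


section \<open>The first input of a feasible decision\<close>

lemma block_diag_mult_component:
  fixes B :: "real^'q^'p" and y :: "real^('h::finite \<times> 'q)"
  shows "(block_diag B *v y) $ (i, l) = (B *v block y i) $ l"
proof -
  have "(block_diag B *v y) $ (i, l) =
      (\<Sum>j\<in>UNIV. \<Sum>k\<in>UNIV. (if i = j then 1 else 0) * B $ l $ k * y $ (j, k))"
    by (simp add: matrix_vector_mult_def block_diag_def kron_def mat_def
        sum.cartesian_product case_prod_unfold flip: UNIV_Times_UNIV)
  also have "\<dots> = (\<Sum>j\<in>UNIV. if j = i then \<Sum>k\<in>UNIV. B $ l $ k * y $ (j, k) else 0)"
    by (rule sum.cong) auto
  finally show ?thesis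
    by (simp add: matrix_vector_mult_def block_def)
qed

lemma strictly_block_lower_first_block:
  fixes M :: "real^('h::{finite,linorder} \<times> 'nx::finite)^('h \<times> 'nu::finite)"
  assumes "strictly_block_lower M"
  shows "block (M *v \<omega>) (Min UNIV) = 0"
proof -
  have "M $ (Min UNIV, l) $ p = 0" for l p
    using assms Min_le[of UNIV "fst p"] by (cases p) (auto simp: strictly_block_lower_def)
  then show ?thesis by (simp add: vec_eq_iff block_def matrix_vector_mult_def)
qed

text \<open>For the chosen point of the polytope, \<open>\<^bold>Z\<^sup>T\<^bold>k\<^sub>w\<close> dominates \<open>\<^bold>Z\<^sup>T\<^bold>H\<^sub>w\<omega> = \<^bold>H\<^sub>u\<^bold>M\<omega>\<close>, whose first block is zero.
  The constraint tightening in the first block is therefore nonnegative, and the tightened constraint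
  implies the original one.\<close>

lemma feasible_first_input:
  fixes S :: "('nx::finite,'nu::finite,'nw::finite,'h::{finite,linorder},'s::finite,'r::finite,'a::finite) smpc_data"
  assumes feas: "feasible S x d" and \<omega>: "\<omega> \<in> sat_polytope S"
  shows "block (dec_v d) (Min UNIV) \<in> input_set S"
proof -
  let ?Z = "dec_Z d" and ?i = "Min UNIV :: 'h"
  have M: "strictly_block_lower (dec_M d)"
    and le: "bHu S *v dec_v d + transpose ?Z *v k_w S \<le> bku S"
    and dual: "transpose ?Z ** H_w S = bHu S ** dec_M d"
    and Z: "\<And>p q. 0 \<le> ?Z $ p $ q"
    using feas by (auto simp: feasible_def)
  have "(H_u S *v block (dec_v d) ?i) $ j \<le> k_u S $ j" for j
  proof -
    have "0 = (bHu S *v (dec_M d *v \<omega>)) $ (?i, j)"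
      by (simp add: bHu_def block_diag_mult_component strictly_block_lower_first_block[OF M])
    also have "\<dots> = (transpose ?Z *v (H_w S *v \<omega>)) $ (?i, j)"
      by (simp add: matrix_vector_mul_assoc dual)
    also have "\<dots> \<le> (transpose ?Z *v k_w S) $ (?i, j)"
      unfolding matrix_vector_mult_def[of "transpose ?Z"] using \<omega> Z
      by (auto simp: sat_polytope_def less_eq_vec_def transpose_def intro!: sum_mono mult_left_mono)
    finally have "(bHu S *v dec_v d) $ (?i, j) \<le> bku S $ (?i, j)"
      using le[unfolded less_eq_vec_def, rule_format, of "(?i, j)"] by simp
    then show ?thesis
      by (simp add: bHu_def bku_def repeat_vec_def block_diag_mult_component)
  qed
  then show ?thesis by (simp add: input_set_def less_eq_vec_def)
qed

text \<open>If the support were empty, null open sets would cover the space; by the Lindelof property countably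
  many of them suffice, and the whole space would be null.\<close>

lemma support_nonempty:
  fixes M :: "'b::second_countable_topology measure"
  assumes sets: "sets M = sets borel" and "emeasure M (space M) \<noteq> 0"
  shows "\<exists>z. \<forall>U. open U \<longrightarrow> z \<in> U \<longrightarrow> 0 < emeasure M U"
proof (rule ccontr)
  let ?F = "{U. open U \<and> emeasure M U = 0}"
  assume "\<not> ?thesis"
  then have cover: "\<Union>?F = UNIV" by (auto simp: zero_less_iff_neq_zero)
  obtain F where F: "F \<subseteq> ?F" "countable F" "\<Union>F = \<Union>?F"
    using Lindelof[of ?F] by blast
  have "(\<Union>U\<in>F. U) \<in> null_sets M"
    using F by (intro null_sets_UN') (auto simp: null_sets_def sets)
  then have "emeasure M UNIV = 0" using F(3) cover by (simp add: null_sets_def)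
  moreover have "space M = UNIV" using sets_eq_imp_space_eq[OF sets] by simp
  ultimately show False using assms(2) by simp
qed


section \<open>Stochastic stability\<close>

lemma norm_squared_eq_trace_outer: "(norm v)\<^sup>2 = (\<Sum>i\<in>UNIV. outer v v $ i $ i)"
  by (simp add: outer_def power2_norm_eq_inner inner_vec_def)

lemma second_moment_eq_trace_covariance:
  assumes "integrable P (\<lambda>\<omega>. outer (w \<omega>) (w \<omega>))"
  shows "integrable P (\<lambda>\<omega>. (norm (w \<omega>))\<^sup>2)"
    and "(LINT \<omega>|P. (norm (w \<omega>))\<^sup>2) = (\<Sum>i\<in>UNIV. (LINT \<omega>|P. outer (w \<omega>) (w \<omega>)) $ i $ i)"
proof -
  have bl: "bounded_linear (\<lambda>B::real^'b^'b. B $ i $ i)" for i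
    by (intro bounded_linear_compose[OF bounded_linear_vec_nth] bounded_linear_vec_nth)
  have int: "integrable P (\<lambda>\<omega>. outer (w \<omega>) (w \<omega>) $ i $ i)" for i
    using integrable_bounded_linear[OF bl assms] .
  then show "integrable P (\<lambda>\<omega>. (norm (w \<omega>))\<^sup>2)"
    by (simp add: norm_squared_eq_trace_outer)
  show "(LINT \<omega>|P. (norm (w \<omega>))\<^sup>2) = (\<Sum>i\<in>UNIV. (LINT \<omega>|P. outer (w \<omega>) (w \<omega>)) $ i $ i)"
    using int by (simp add: norm_squared_eq_trace_outer integral_bounded_linear[OF bl assms])
qed

theorem theorem2:
  fixes S :: "('nx::finite,'nu::finite,'nw::finite,'h::{finite,linorder},'s::finite,'r::finite,'a::finite) smpc_data"
    and P :: "'o measure"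
    and w :: "nat \<Rightarrow> 'o \<Rightarrow> real^'nw"
    and opt :: "real^'nx \<Rightarrow> ('nx,'nu,'h,'s,'r,'a) decision"
    and \<kappa> :: "real^'nx \<Rightarrow> real^'nu"
    and x :: "real^'nx \<Rightarrow> nat \<Rightarrow> 'o \<Rightarrow> real^'nx"
  assumes stable: "schur_stable (A_mat S)"
    and prob: "prob_space P"
    and dens_nonneg: "\<And>z. 0 \<le> p_w S z"
    and dens_meas: "p_w S \<in> borel_measurable borel"
    and w_dens: "\<And>t. distributed P lborel (w t) (\<lambda>z. ennreal (p_w S z))"
    and w_indep: "prob_space.indep_vars P (\<lambda>_. borel) w UNIV"
    and w_mean: "\<And>t. integrable P (w t) \<and> (LINT \<omega>|P. w t \<omega>) = 0"
    and w_cov: "\<And>t. integrable P (\<lambda>\<omega>. outer (w t \<omega>) (w t \<omega>)) \<and>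
                  (LINT \<omega>|P. outer (w t \<omega>) (w t \<omega>)) = Sigma_w S"
    and Sigma_pd: "sym_pd (Sigma_w S)"
    and U_compact: "compact (input_set S)"
    and U_origin: "0 \<in> interior (input_set S)"
    and beta: "0 \<le> beta S" "beta S < 1"
    and Q_psd: "sym_psd (Q_wt S)"
    and R_psd: "sym_psd (R_wt S)"
    and phi_meas: "\<And>i l. phi S i l \<in> borel_measurable borel"
    and phi_bound: "\<And>i l a. \<bar>phi S i l a\<bar> \<le> phi_max S"
    and W_polytope: "polytope (sat_polytope S)"
    and phi_in_W: "\<And>z :: real^('h \<times> 'nw). (\<forall>i. block z i \<in> dist_support S) \<Longrightarrow>
                     saturate S (bG S *v z) \<in> sat_polytope S"
    and rho: "0 \<le> rho S"
    and delta: "\<And>j. 0 \<le> delta S j"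
    and alpha: "\<And>j. 0 \<le> alpha S j \<and> alpha S j < 1"
    and alpha_sum: "(\<Sum>j\<in>UNIV. alpha S j) = beta S"
    and phi_mean: "(LINT z|stacked_law S. saturate S (bG S *v z)) = 0"
    and opt: "\<And>y. is_optimizer S y (opt y)"
    and kappa: "\<And>y. \<kappa> y = block (dec_v (opt y)) (Min UNIV)"
    and kappa_meas: "\<kappa> \<in> borel_measurable borel"
    and init: "\<And>x0 \<omega>. \<omega> \<in> space P \<Longrightarrow> x x0 0 \<omega> = x0"
    and step: "\<And>x0 t \<omega>. \<omega> \<in> space P \<Longrightarrow>
                 x x0 (Suc t) \<omega> = A_mat S *v x x0 t \<omega> + B_mat S *v \<kappa> (x x0 t \<omega>) + G_mat S *v w t \<omega>"
  shows "\<forall>x0. (SUP t. \<integral>\<^sup>+ \<omega>. ennreal ((norm (x x0 t \<omega>))\<^sup>2) \<partial>P) < \<infinity>"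
proof -
  interpret prob_space P by (rule prob)
  have law: "dist_law S = distr P lborel (w 0)"
    using distributed_distr_eq_density[OF w_dens[of 0]] by (simp add: dist_law_def)
  have "prob_space (dist_law S)"
    unfolding law by (rule prob_space_distr) (rule distributed_measurable[OF w_dens])
  then have "emeasure (dist_law S) (space (dist_law S)) \<noteq> 0"
    by (simp only: prob_space.emeasure_space_1 one_neq_zero not_False_eq_True)
  then obtain z0 where z0: "z0 \<in> dist_support S"
    using support_nonempty[of "dist_law S"] by (auto simp: dist_support_def dist_law_def)
  (* A constant sequence of disturbances in the support shows that the polytope is nonempty. *)
  have "saturate S (bG S *v repeat_vec z0) \<in> sat_polytope S"
    using z0 by (intro phi_in_W) (simp add: block_def repeat_vec_def)
  then have \<kappa>_in_U: "\<kappa> y \<in> input_set S" for y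
    unfolding kappa using opt[of y] by (auto simp: is_optimizer_def intro: feasible_first_input)
  obtain c where c: "\<And>u. u \<in> input_set S \<Longrightarrow> norm (B_mat S *v u) \<le> c"
    using compact_imp_bounded[OF compact_continuous_image[OF _ U_compact, of "(*v) (B_mat S)"]]
    by (auto simp: bounded_iff intro: matrix_vector_mult_linear_continuous_on)
  let ?g = "onorm ((*v) (G_mat S))"
  show ?thesis
  proof
    fix x0
    show "(SUP t. \<integral>\<^sup>+ \<omega>. ennreal ((norm (x x0 t \<omega>))\<^sup>2) \<partial>P) < \<infinity>"
    proof (rule mean_square_bounded_of_schur_stable[OF prob stable, where w = w])
      show "x x0 (Suc t) \<omega> = A_mat S *v x x0 t \<omega> + (B_mat S *v \<kappa> (x x0 t \<omega>) + G_mat S *v w t \<omega>)"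
        if "\<omega> \<in> space P" for t \<omega> using step[OF that] by simp
      show "norm (B_mat S *v \<kappa> (x x0 t \<omega>) + G_mat S *v w t \<omega>) \<le> c + ?g * norm (w t \<omega>)" for t \<omega>
        by (intro norm_triangle_mono c \<kappa>_in_U onorm matrix_vector_mul_bounded_linear)
      show "integrable P (\<lambda>\<omega>. (norm (w t \<omega>))\<^sup>2)"
        "(LINT \<omega>|P. (norm (w t \<omega>))\<^sup>2) \<le> (\<Sum>i\<in>UNIV. Sigma_w S $ i $ i)" for t
        using second_moment_eq_trace_covariance[of P "w t"] w_cov[of t] by auto
    qed (rule init)
  qed
qed

end
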